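(* There exists a constant $\gamma>0$ such that $p_3(3,q)>q^2e^{-\gamma\sqrt{\log q}}$ for all integers $q\ge 3$.
   Context: A $PHF(N;n,q,t)$ is an $N\times n$ matrix over $[q]$ such that for every set of $t$ columns there is a row in which these $t$ columns have pairwise distinct entries; $p_t(N,q)$ is the maximum $n$ for which such a matrix exists. *)

theory Defs
  imports Complex_Main "HOL-Library.FuncSet"
begin

text \<open>The matrix entry in row \<open>i < N\<close> and column \<open>j < n\<close> is \<open>M i j\<close>; values of \<open>M\<close> outside this
  index range are irrelevant. The alphabet \<open>[q]\<close> is \<open>{1..q}\<close>.\<close>

definition is_PHF :: "nat \<Rightarrow> nat \<Rightarrow> nat \<Rightarrow> nat \<Rightarrow> (nat \<Rightarrow> nat \<Rightarrow> nat) \<Rightarrow> bool" where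
  "is_PHF N n q t M \<longleftrightarrow>
     (\<forall>i<N. \<forall>j<n. M i j \<in> {1..q}) \<and>
     (\<forall>T. T \<subseteq> {..<n} \<and> card T = t \<longrightarrow> (\<exists>i<N. inj_on (M i) T))"

definition phf_max :: "nat \<Rightarrow> nat \<Rightarrow> nat \<Rightarrow> nat" where
  "phf_max t N q = Max {n. \<exists>M. is_PHF N n q t M}"

text \<open>For \<open>t \<ge> 2\<close> the maximum is taken over a finite nonempty set, since the columns of a matrix with
  at least \<open>t\<close> columns are pairwise distinct.\<close>

lemma is_PHF_bound:
  assumes "is_PHF N n q t M" "2 \<le> t"
  shows "n \<le> max t (q ^ N)"
proof (cases "n < t")
  case False
  let ?c = "\<lambda>j. restrict (\<lambda>i. M i j) {..<N}"
  have "inj_on ?c {..<n}"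
  proof (rule inj_onI, rule ccontr)
    fix a b assume ab: "a \<in> {..<n}" "b \<in> {..<n}" "?c a = ?c b" "a \<noteq> b"
    have "t - 2 \<le> card ({..<n} - {a, b})"
      using False ab by (simp add: card_Diff_subset)
    then obtain S where S: "S \<subseteq> {..<n} - {a, b}" "card S = t - 2" "finite S"
      by (meson obtain_subset_with_card_n)
    have "card (insert a (insert b S)) = t"
      using S ab assms(2) by (subst card_insert_disjoint; (subst card_insert_disjoint)?; auto)
    moreover have "insert a (insert b S) \<subseteq> {..<n}" using S ab by auto
    ultimately obtain i where i: "i < N" "inj_on (M i) (insert a (insert b S))"
      using assms(1) unfolding is_PHF_def by blast
    have "M i a = M i b" using fun_cong[OF ab(3), of i] i(1) by simp
    then show False using i(2) ab(4) by (auto dest: inj_onD)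
  qed
  moreover have "?c ` {..<n} \<subseteq> {..<N} \<rightarrow>\<^sub>E {1..q}"
    using assms(1) unfolding is_PHF_def by (auto split: if_splits)
  ultimately have "card {..<n} \<le> card ({..<N} \<rightarrow>\<^sub>E {1..q})"
    by (rule card_inj_on_le) (simp add: finite_PiE)
  then show ?thesis by (simp add: card_PiE)
qed simp

lemma finite_PHF_sizes: "2 \<le> t \<Longrightarrow> finite {n. \<exists>M. is_PHF N n q t M}"
  by (rule finite_subset[of _ "{..max t (q ^ N)}"]) (use is_PHF_bound in blast)+

lemma PHF_sizes_nonempty: "0 < t \<Longrightarrow> {n. \<exists>M. is_PHF N n q t M} \<noteq> {}"
  by (auto simp: is_PHF_def intro!: exI[of _ 0])

end

theory Submission
  imports Defs
begin

text \<open>If \<open>A \<subseteq> {0..<m}\<close> contains no nontrivial three-term arithmetic progression and \<open>3 m \<le> q\<close>, then the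
  columns \<open>(x, x + a, x + 2 a)\<close> with \<open>x \<in> {1..m}\<close>, \<open>a \<in> A\<close> form a perfect hash family: two columns
  agreeing in two rows coincide, so three unseparated columns would have to agree pairwise in three
  different rows, which forces \<open>b + c = 2 a\<close> on the corresponding elements of \<open>A\<close>
  (Ruzsa--Szemeredi). A dense \<open>A\<close> is obtained as in Behrend's theorem: vectors in \<open>{0..<d}\<^sup>k\<close> of a
  fixed Euclidean norm, read as digit strings in base \<open>2 d\<close>. Addition of two such strings has no
  carries, so a progression in \<open>A\<close> gives a midpoint on a sphere. With \<open>2 d = 2\<^sup>k\<close> and
  \<open>3 \<cdot> 2^k\<^sup>2 \<le> q < 3 \<cdot> 2^(k+1)\<^sup>2\<close> the total loss is a factor \<open>2^O(k)\<close>.\<close>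

section \<open>Digit expansions, spheres and Behrend's progression-free sets\<close>

definition progression_free :: "nat set \<Rightarrow> bool" where
  "progression_free A \<longleftrightarrow> (\<forall>a\<in>A. \<forall>b\<in>A. \<forall>c\<in>A. b + c = 2 * a \<longrightarrow> b = a \<and> c = a)"

lemma digits_sum_less:
  fixes x :: "nat \<Rightarrow> nat"
  assumes "\<And>i. i < k \<Longrightarrow> x i < b"
  shows "(\<Sum>i<k. x i * b ^ i) < b ^ k"
  using assms
proof (induction k)
  case (Suc k)
  have "(\<Sum>i<Suc k. x i * b ^ i) < b ^ k + x k * b ^ k"
    using Suc by simp
  also have "\<dots> = (x k + 1) * b ^ k" by simp
  also have "\<dots> \<le> b * b ^ k"
    using Suc.prems[of k] by (intro mult_right_mono) auto
  finally show ?case by simp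
qed simp

lemma digits_sum_eqD:
  fixes x y :: "nat \<Rightarrow> nat"
  assumes "\<And>i. i < k \<Longrightarrow> x i < b" "\<And>i. i < k \<Longrightarrow> y i < b"
    and "(\<Sum>i<k. x i * b ^ i) = (\<Sum>i<k. y i * b ^ i)" and "i < k"
  shows "x i = y i"
  using assms
proof (induction k arbitrary: i)
  case (Suc k)
  have x: "(\<Sum>i<k. x i * b ^ i) < b ^ k" and y: "(\<Sum>i<k. y i * b ^ i) < b ^ k"
    using Suc.prems by (auto intro: digits_sum_less)
  \<comment> \<open>The lower digits sum to less than \<open>b ^ k\<close>, so division by
    \<open>b ^ k\<close> isolates the top digit.\<close>
  have "((\<Sum>i<k. x i * b ^ i) + x k * b ^ k) div b ^ k = ((\<Sum>i<k. y i * b ^ i) + y k * b ^ k) div b ^ k"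
    using Suc.prems(3) by simp
  moreover have "b ^ k \<noteq> 0" using x by linarith
  ultimately have top: "x k = y k" using x y by simp
  then have "(\<Sum>i<k. x i * b ^ i) = (\<Sum>i<k. y i * b ^ i)"
    using Suc.prems(3) by simp
  with Suc.IH Suc.prems top show ?case by (metis less_Suc_eq)
qed simp

text \<open>Strict convexity of the sphere: by the parallelogram law, |y - z|^2 = 2|y|^2 + 2|z|^2 -
  |2x|^2 = 2r + 2r - 4r = 0.\<close>

lemma midpoint_on_sphere_eq:
  fixes x y z :: "nat \<Rightarrow> nat"
  assumes mid: "\<And>i. i < k \<Longrightarrow> y i + z i = 2 * x i"
    and r: "(\<Sum>i<k. (x i)\<^sup>2) = r" "(\<Sum>i<k. (y i)\<^sup>2) = r" "(\<Sum>i<k. (z i)\<^sup>2) = r"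
    and "i < k"
  shows "y i = x i \<and> z i = x i"
proof -
  \<comment> \<open>Differences are taken in \<open>int\<close> because subtraction on
    \<open>nat\<close> truncates.\<close>
  have "(int (y i) - int (z i))\<^sup>2 = 2 * int ((y i)\<^sup>2) + 2 * int ((z i)\<^sup>2) - 4 * int ((x i)\<^sup>2)"
    if "i < k" for i
  proof -
    have "int (y i) + int (z i) = 2 * int (x i)" using mid[OF that] by linarith
    then have "(int (y i) + int (z i))\<^sup>2 = (2 * int (x i))\<^sup>2" by simp
    then show ?thesis by (simp add: power2_eq_square algebra_simps)
  qed
  then have "(\<Sum>i<k. (int (y i) - int (z i))\<^sup>2)
      = (\<Sum>i<k. 2 * int ((y i)\<^sup>2) + 2 * int ((z i)\<^sup>2) - 4 * int ((x i)\<^sup>2))"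
    by (intro sum.cong) auto
  also have "\<dots> = 2 * int (\<Sum>i<k. (y i)\<^sup>2) + 2 * int (\<Sum>i<k. (z i)\<^sup>2) - 4 * int (\<Sum>i<k. (x i)\<^sup>2)"
    by (simp only: sum.distrib sum_subtractf sum_distrib_left of_nat_sum)
  also have "\<dots> = 0" using r by simp
  finally have "\<forall>i\<in>{..<k}. (int (y i) - int (z i))\<^sup>2 = 0"
    by (subst (asm) sum_nonneg_eq_0_iff) auto
  then have "y i = z i" using \<open>i < k\<close> by simp
  then show ?thesis using mid[OF \<open>i < k\<close>] by simp
qed

text \<open>Pigeonhole: squared norms on the cube lie in \<open>{..k * d\<^sup>2}\<close>, so one of
  these \<open>k * d\<^sup>2 + 1\<close> spheres carries at least the average number of
  points.\<close>

lemma behrend: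
  obtains A where "A \<subseteq> {..<(2 * d) ^ k}" "progression_free A" "d ^ k \<le> card A * (k * d\<^sup>2 + 1)"
proof -
  define V where "V = {..<k} \<rightarrow>\<^sub>E {..<d}"
  define nrm :: "(nat \<Rightarrow> nat) \<Rightarrow> nat" where "nrm x = (\<Sum>i<k. (x i)\<^sup>2)" for x
  define enc :: "(nat \<Rightarrow> nat) \<Rightarrow> nat" where "enc x = (\<Sum>i<k. x i * (2 * d) ^ i)" for x
  have V_less: "x i < d" if "x \<in> V" "i < k" for x i
    using that unfolding V_def by auto
  have V_ext: "x = y" if "x \<in> V" "y \<in> V" "\<And>i. i < k \<Longrightarrow> x i = y i" for x y
    using that unfolding V_def by (auto intro: PiE_ext)
  have cardV: "card V = d ^ k" unfolding V_def by (simp add: card_PiE)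
  have nrmV: "nrm ` V \<subseteq> {..k * d\<^sup>2}"
  proof (rule image_subsetI)
    fix x assume "x \<in> V"
    then have "nrm x \<le> (\<Sum>i<k. d\<^sup>2)"
      unfolding nrm_def by (intro sum_mono power_mono) (auto dest: V_less)
    then show "nrm x \<in> {..k * d\<^sup>2}" by simp
  qed
  define S where "S r = {x \<in> V. nrm x = r}" for r
  have "\<exists>r. d ^ k \<le> card (S r) * (k * d\<^sup>2 + 1)"
  proof (rule ccontr)
    assume "\<nexists>r. d ^ k \<le> card (S r) * (k * d\<^sup>2 + 1)"
    then have small: "card (S r) * (k * d\<^sup>2 + 1) < d ^ k" for r by (meson not_le)
    have "V = (\<Union>r\<in>{..k * d\<^sup>2}. S r)" using nrmV by (auto simp: S_def)
    then have "d ^ k \<le> (\<Sum>r\<le>k * d\<^sup>2. card (S r))"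
      using card_UN_le[of "{..k * d\<^sup>2}" S] cardV by simp
    then have "d ^ k * (k * d\<^sup>2 + 1) \<le> (\<Sum>r\<le>k * d\<^sup>2. card (S r) * (k * d\<^sup>2 + 1))"
      by (metis mult_right_mono sum_distrib_right zero_le)
    also have "\<dots> < (\<Sum>r\<le>k * d\<^sup>2. d ^ k)"
      by (intro sum_strict_mono small) auto
    finally show False by simp
  qed
  then obtain r where r: "d ^ k \<le> card (S r) * (k * d\<^sup>2 + 1)" by blast
  have S: "x \<in> V" "nrm x = r" if "x \<in> S r" for x using that by (auto simp: S_def)
  have inj: "inj_on enc (S r)"
  proof (rule inj_onI)
    fix x y assume xy: "x \<in> S r" "y \<in> S r" "enc x = enc y"
    have "x i < 2 * d" "y i < 2 * d" if "i < k" for i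
      using V_less[OF S(1)[OF xy(1)] that] V_less[OF S(1)[OF xy(2)] that] by auto
    then have "x i = y i" if "i < k" for i
      using digits_sum_eqD[of k x "2 * d" y i] xy(3) that by (auto simp: enc_def)
    then show "x = y" using V_ext xy S by blast
  qed
  have "enc ` S r \<subseteq> {..<(2 * d) ^ k}"
  proof (rule image_subsetI)
    fix x assume "x \<in> S r"
    then have "x i < 2 * d" if "i < k" for i using V_less[OF S(1) that, of x] by simp
    then show "enc x \<in> {..<(2 * d) ^ k}" unfolding enc_def lessThan_iff by (rule digits_sum_less)
  qed
  moreover have "progression_free (enc ` S r)"
    unfolding progression_free_def
  proof clarify
    fix x y z assume xyz: "x \<in> S r" "y \<in> S r" "z \<in> S r" and e: "enc y + enc z = 2 * enc x"
    \<comment> \<open>Digits below \<open>d\<close> stay below \<open>2 * d\<close> when added or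
      doubled, so \<open>e\<close> equates two genuine expansions in base \<open>2 * d\<close> and
      holds digit by digit.\<close>
    have mid: "y i + z i = 2 * x i" if "i < k" for i
    proof (rule digits_sum_eqD[of k "\<lambda>i. y i + z i" "2 * d" "\<lambda>i. 2 * x i"])
      fix j assume "j < k"
      then have "x j < d" "y j < d" "z j < d" using xyz V_less S(1) by blast+
      then show "y j + z j < 2 * d" "2 * x j < 2 * d" by auto
    next
      show "(\<Sum>i<k. (y i + z i) * (2 * d) ^ i) = (\<Sum>i<k. 2 * x i * (2 * d) ^ i)"
        using e by (simp add: enc_def sum_distrib_left sum.distrib algebra_simps)
    qed (fact that)
    have "y i = x i \<and> z i = x i" if "i < k" for i
      using mid xyz[THEN S(2)] that by (intro midpoint_on_sphere_eq[of k y z x r]) (auto simp: nrm_def)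
    then have "y = x" "z = x" using V_ext xyz S(1) by blast+
    then show "enc y = enc x \<and> enc z = enc x" by simp
  qed
  ultimately show thesis
    using r by (intro that[of "enc ` S r"]) (simp_all add: card_image[OF inj])
qed

text \<open>The choice \<open>d = 2 ^ (k - 1)\<close> turns \<open>(2 * d) ^ k\<close> into
  \<open>2 ^ k\<^sup>2\<close>. Of the loss \<open>2 ^ (4 * k)\<close>, a factor
  \<open>2 ^ k\<close> comes from using only digits below half the base and
  \<open>2 ^ (3 * k)\<close> bounds the number of norms.\<close>

corollary behrend_pow2:
  obtains A where "A \<subseteq> {..<2 ^ k\<^sup>2}" "progression_free A" "2 ^ k\<^sup>2 \<le> card A * 2 ^ (4 * k)"
proof (cases k)
  case 0
  then show thesis by (intro that[of "{0}"]) (auto simp: progression_free_def)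
next
  case (Suc l)
  obtain A where A: "A \<subseteq> {..<(2 * 2 ^ l) ^ k}" "progression_free A"
    "(2 ^ l) ^ k \<le> card A * (k * (2 ^ l)\<^sup>2 + 1)"
    using behrend[of "2 ^ l" k] by auto
  have base: "(2 * 2 ^ l) ^ k = (2::nat) ^ k\<^sup>2"
    by (simp add: Suc power2_eq_square flip: power_Suc power_mult)
  have "k * (2 ^ l)\<^sup>2 + 1 \<le> (k + 1) * (2 ^ l)\<^sup>2" by simp
  \<comment> \<open>Here \<open>k + 1 \<le> 2 ^ k\<close> absorbs the polynomial factor.\<close>
  also have "\<dots> \<le> 2 ^ k * (2 ^ k)\<^sup>2"
    using less_exp[of k] by (intro mult_mono power_mono) (auto simp: Suc)
  also have "\<dots> = 2 ^ (3 * k)"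
    by (simp flip: power_add power_mult)
  finally have *: "k * (2 ^ l)\<^sup>2 + 1 \<le> (2::nat) ^ (3 * k)" .
  have "(2::nat) ^ k\<^sup>2 = 2 ^ k * (2 ^ l) ^ k" using base by (simp add: power_mult_distrib)
  also have "\<dots> \<le> 2 ^ k * (card A * 2 ^ (3 * k))"
    using A(3) * by (meson le_trans mult_le_mono2)
  also have "\<dots> = card A * 2 ^ (k + 3 * k)" by (simp only: power_add mult_ac)
  finally show thesis using A base by (intro that[of A]) auto
qed

section \<open>Perfect hash families from progression-free sets\<close>

lemma card_le_phf_max:
  assumes "finite J" "2 \<le> t"
    and "\<And>i j. i < N \<Longrightarrow> j \<in> J \<Longrightarrow> f i j \<in> {1..q}"
    and sep: "\<And>T. T \<subseteq> J \<Longrightarrow> card T = t \<Longrightarrow> \<exists>i<N. inj_on (f i) T"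
  shows "card J \<le> phf_max t N q"
proof -
  \<comment> \<open>An enumeration of \<open>J\<close> lets columns be indexed by arbitrary objects,
    later by pairs \<open>(x, a)\<close>.\<close>
  obtain h where h: "bij_betw h {..<card J} J"
    using ex_bij_betw_nat_finite[OF \<open>finite J\<close>] by (auto simp: atLeast0LessThan)
  have "is_PHF N (card J) q t (\<lambda>i j. f i (h j))"
    unfolding is_PHF_def
  proof (intro conjI allI impI)
    fix i j assume "i < N" "j < card J"
    then show "f i (h j) \<in> {1..q}" using assms(3) h by (meson bij_betwE lessThan_iff)
  next
    fix T assume T: "T \<subseteq> {..<card J} \<and> card T = t"
    then have inj: "inj_on h T" using h by (meson bij_betw_imp_inj_on inj_on_subset)
    have "h ` T \<subseteq> J" using T h by (auto dest: bij_betwE)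
    moreover have "card (h ` T) = t" using T inj by (simp add: card_image)
    ultimately obtain i where "i < N" "inj_on (f i) (h ` T)" using sep by blast
    then show "\<exists>i<N. inj_on (\<lambda>j. f i (h j)) T"
      using comp_inj_on[OF inj, of "f i"] by (auto simp: comp_def)
  qed
  then show ?thesis
    unfolding phf_max_def using finite_PHF_sizes[OF \<open>2 \<le> t\<close>] by (intro Max_ge) auto
qed

lemma phf_max_ge_progression_free:
  assumes A: "A \<subseteq> {..<m}" "progression_free A" and "3 * m \<le> q"
  shows "m * card A \<le> phf_max 3 3 q"
proof -
  define J where "J = {1..m} \<times> A"
  define f :: "nat \<Rightarrow> nat \<times> nat \<Rightarrow> nat" where "f i u = fst u + i * snd u" for i u
  have fin: "finite J" using A(1) finite_subset by (auto simp: J_def)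
  \<comment> \<open>A column samples the line \<open>x + i * a\<close>, and two samples determine a
    line.\<close>
  have linear: "u = v" if "i \<noteq> j" "f i u = f i v" "f j u = f j v" for i j u v
  proof -
    have "int i * (int (snd u) - int (snd v)) = int (fst v) - int (fst u)"
      "int j * (int (snd u) - int (snd v)) = int (fst v) - int (fst u)"
      using that(2,3)[THEN arg_cong[where f=int]] by (simp_all add: f_def algebra_simps)
    then have "(int i - int j) * (int (snd u) - int (snd v)) = 0"
      by (simp add: algebra_simps)
    then have "snd u = snd v" using that(1) by simp
    then show ?thesis using that(2) by (simp add: f_def prod_eq_iff)
  qed
  \<comment> \<open>Row 0 gives \<open>fst u = fst v\<close>; eliminating \<open>fst w\<close> from
    rows 1 and 2 then makes \<open>snd u\<close> the midpoint of \<open>snd v\<close> and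
    \<open>snd w\<close>.\<close>
  have triangle: "u = v" if "u \<in> J" "v \<in> J" "w \<in> J" "f 0 u = f 0 v" "f 1 v = f 1 w" "f 2 u = f 2 w"
    for u v w
  proof -
    have "snd v + snd w = 2 * snd u" using that(4-6) by (simp add: f_def)
    then have "snd v = snd u"
      using A(2) that(1-3) unfolding progression_free_def J_def by auto
    then show ?thesis using that(4) by (simp add: f_def prod_eq_iff)
  qed
  have "card J \<le> phf_max 3 3 q"
  proof (rule card_le_phf_max[where f=f])
    fix i u assume "i < (3::nat)" "u \<in> J"
    then have "i * snd u \<le> 2 * snd u" "snd u < m" "fst u \<in> {1..m}"
      using A(1) by (auto simp: J_def)
    \<comment> \<open>Entries are at most m + 2(m - 1), hence below \<open>3 * m\<close>; the offset
      \<open>x\<close> starts at 1, as the alphabet does.\<close>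
    then have "1 \<le> fst u + i * snd u" "fst u + i * snd u \<le> q" 
      using \<open>3 * m \<le> q\<close> unfolding atLeastAtMost_iff by linarith+
    then show "f i u \<in> {1..q}" by (simp add: f_def)
  next
    fix T assume T: "T \<subseteq> J" "card T = 3"
    then obtain u v w where uvw: "T = {u, v, w}" "u \<noteq> v" "v \<noteq> w" "u \<noteq> w"
      by (auto simp: card_3_iff)
    have J: "u \<in> J" "v \<in> J" "w \<in> J" using T uvw by auto
    show "\<exists>i<3. inj_on (f i) T"
    proof (rule ccontr)
      assume "\<not> (\<exists>i<3. inj_on (f i) T)"
      then have coll: "f i u = f i v \<or> f i v = f i w \<or> f i u = f i w" if "i < 3" for i
        using that uvw by (auto simp: inj_on_def)
      have "(0::nat) \<noteq> 1" "(0::nat) \<noteq> 2" "(1::nat) \<noteq> 2" by auto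
      note lin = this[THEN linear]
      have "f 0 u = f 0 v \<or> f 0 v = f 0 w \<or> f 0 u = f 0 w"
        "f 1 u = f 1 v \<or> f 1 v = f 1 w \<or> f 1 u = f 1 w"
        "f 2 u = f 2 v \<or> f 2 v = f 2 w \<or> f 2 u = f 2 w"
        by (rule coll; simp)+
      \<comment> \<open>A pair colliding in two rows contradicts \<open>lin\<close>. Otherwise the
        three pairs are distributed over the three rows, and each of the six orders is one instance
        of \<open>triangle\<close>.\<close>
      then show False
        using lin[of u v] lin[of v w] lin[of u w] uvw(2-4)
          triangle[OF J(1,2,3)] triangle[OF J(1,3,2)] triangle[OF J(2,1,3)]
          triangle[OF J(2,3,1)] triangle[OF J(3,1,2)] triangle[OF J(3,2,1)]
        by (elim disjE) simp_all
    qed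
  qed (use fin in auto)
  then show ?thesis by (simp add: J_def card_cartesian_product)
qed

section \<open>Choice of parameters and the final estimate\<close>

lemma phf_max_ge_pow2:
  assumes "3 * 2 ^ k\<^sup>2 \<le> q"
  shows "2 ^ (2 * k\<^sup>2) \<le> phf_max 3 3 q * 2 ^ (4 * k)"
proof -
  obtain A where A: "A \<subseteq> {..<2 ^ k\<^sup>2}" "progression_free A" "2 ^ k\<^sup>2 \<le> card A * 2 ^ (4 * k)"
    by (rule behrend_pow2)
  have "2 ^ (2 * k\<^sup>2) = (2::nat) ^ k\<^sup>2 * 2 ^ k\<^sup>2" by (simp flip: power_add)
  also have "\<dots> \<le> 2 ^ k\<^sup>2 * card A * 2 ^ (4 * k)"
    using A(3) by simp
  also have "\<dots> \<le> phf_max 3 3 q * 2 ^ (4 * k)"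
    using phf_max_ge_progression_free[OF A(1,2) assms] by (intro mult_right_mono) auto
  finally show ?thesis .
qed

lemma between_pow2_squares:
  assumes "3 \<le> q"
  obtains k where "3 * 2 ^ k\<^sup>2 \<le> q" "q < 3 * (2::nat) ^ (Suc k)\<^sup>2"
proof -
  let ?P = "\<lambda>k. 3 * 2 ^ k\<^sup>2 \<le> q"
  have bound: "k \<le> q" if "?P k" for k
  proof -
    have "k \<le> k\<^sup>2" by (simp add: power2_eq_square)
    also have "\<dots> < 2 ^ k\<^sup>2" by (rule less_exp)
    finally show ?thesis using that by linarith
  qed
  \<comment> \<open>Since \<open>2 ^ 0 = 1\<close>, this is exactly \<open>3 \<le> q\<close>; with
    \<open>bound\<close> it guarantees a greatest \<open>k\<close>.\<close>
  have "?P 0" using assms by simp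
  then have "?P (Greatest ?P)" by (rule GreatestI_nat) (rule bound)
  moreover have "\<not> ?P (Suc (Greatest ?P))"
  proof
    assume "?P (Suc (Greatest ?P))"
    then have "Suc (Greatest ?P) \<le> Greatest ?P" by (rule Greatest_le_nat) (rule bound)
    then show False by simp
  qed
  ultimately show thesis by (intro that[of "Greatest ?P"]) (simp_all only: not_le)
qed

theorem theorem5p6:
  "\<exists>\<gamma>::real. \<gamma> > 0 \<and>
     (\<forall>q::nat. q \<ge> 3 \<longrightarrow>
        real (phf_max 3 3 q) > (real q)\<^sup>2 * exp (- \<gamma> * sqrt (ln (real q))))"
proof (intro exI[of _ 14] conjI allI impI)
  \<comment> \<open>The constant is 14 = 8 + 6: the total loss is \<open>2 ^ (8 * k + 6)\<close>,
    where \<open>real k * ln 2 \<le> ?s\<close> and \<open>ln 2 \<le> 1 \<le> ?s\<close>.\<close>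
  fix q :: nat assume q: "q \<ge> 3"
  obtain k where k: "3 * 2 ^ k\<^sup>2 \<le> q" "q < 3 * (2::nat) ^ (Suc k)\<^sup>2"
    using between_pow2_squares[OF q] .
  let ?n = "phf_max 3 3 q"
  let ?s = "sqrt (ln (real q))"
  have "q\<^sup>2 < (3 * 2 ^ (Suc k)\<^sup>2)\<^sup>2" using k(2) by (intro power_strict_mono) auto
  \<comment> \<open>Uses 9 \<le> 2^4; then 4 + 2(k + 1)^2 = 2k^2 + 4k + 6. The other
    \<open>4 * k\<close> in the final exponent is Behrend's loss.\<close>
  also have "\<dots> \<le> 2 ^ 4 * 2 ^ (2 * (Suc k)\<^sup>2)" by (simp add: power_mult_distrib power_even_eq)
  also have "\<dots> = 2 ^ (2 * k\<^sup>2) * 2 ^ (4 * k + 6)"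
    by (simp add: power2_eq_square algebra_simps power_add)
  also have "\<dots> \<le> ?n * 2 ^ (4 * k) * 2 ^ (4 * k + 6)"
    using phf_max_ge_pow2[OF k(1)] by (intro mult_right_mono) auto
  also have "\<dots> = ?n * 2 ^ (8 * k + 6)" by (simp flip: power_add)
  finally have "real (q\<^sup>2) < real (?n * 2 ^ (8 * k + 6))" by (simp only: of_nat_less_iff)
  then have main: "(real q)\<^sup>2 < real ?n * 2 ^ (8 * k + 6)" by simp
  have ln2: "0 < ln (2::real)" "ln (2::real) \<le> 1" using ln_le_minus_one[of "2::real"] by auto
  have "(2::real) ^ k\<^sup>2 = real (2 ^ k\<^sup>2)" by simp
  also have "\<dots> \<le> real q" using k(1) by (intro of_nat_mono) linarith
  finally have "ln ((2::real) ^ k\<^sup>2) \<le> ln (real q)" using q by (subst ln_le_cancel_iff) auto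
  then have k2: "real k ^ 2 * ln 2 \<le> ln (real q)" by (simp add: ln_realpow)
  \<comment> \<open>One factor \<open>ln 2 \<le> 1\<close> is dropped so that \<open>k2\<close>
    bounds the square by \<open>ln (real q)\<close>.\<close>
  have "(real k * ln 2)\<^sup>2 = real k ^ 2 * ln 2 * ln 2" by (simp add: power2_eq_square)
  also have "\<dots> \<le> real k ^ 2 * ln 2 * 1" using ln2 by (intro mult_left_mono) auto
  finally have "real k * ln 2 \<le> ?s" using k2 by (intro real_le_rsqrt) simp
  moreover have "1 \<le> ?s"
  proof -
    \<comment> \<open>From e \<le> 3 \<le> q; the resulting \<open>1 \<le> ?s\<close> absorbs the
      additive 6.\<close>
    have "exp 1 \<le> real q" using exp_le q by linarith
    then have "1 \<le> ln (real q)" using q by (subst ln_ge_iff) auto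
    then show ?thesis by simp
  qed
  moreover have "real (8 * k + 6) * ln 2 = 8 * (real k * ln 2) + 6 * ln 2"
    by (simp add: algebra_simps)
  ultimately have "real (8 * k + 6) * ln 2 \<le> 14 * ?s"
    using ln2 by linarith
  then have "exp (real (8 * k + 6) * ln 2) \<le> exp (14 * ?s)" by simp
  then have "(2::real) ^ (8 * k + 6) \<le> exp (14 * ?s)"
    by (simp only: exp_of_nat_mult) simp
  then have "real ?n * 2 ^ (8 * k + 6) \<le> real ?n * exp (14 * ?s)" by (intro mult_left_mono) auto
  with main have "(real q)\<^sup>2 < real ?n * exp (14 * ?s)" by linarith
  then show "(real q)\<^sup>2 * exp (- 14 * ?s) < real ?n"
    by (simp add: exp_minus field_simps)
qed simp

end
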